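(* Let $\Phi$ be a $\vdash$-consistent set of DAL formulas and $\Delta$ a set of basic deontic defaults. Then there exists an algebraic extension $(P,F)$ of $\Phi$ under $\Delta$, i.e., a pair of ideals of $\mathbf{L}_\Phi$ with $(P,F)=E^{\Delta}_{\Phi}(P,F)$.
   Context: DAL syntax: actions $\alpha ::= a_i \mid \alpha\sqcup\alpha\mid\alpha\sqcap\alpha\mid\overline{\alpha}\mid 0\mid 1$ over countably many basic actions $a_i$; formulas $\varphi ::= \neg\varphi\mid\varphi\vee\varphi\mid\alpha=\beta\mid\mathsf{P}(\alpha)\mid\mathsf{F}(\alpha)$. DAL provability $\vdash$ is the Hilbert system (modus ponens only) with axioms: classical propositional axioms; Boolean algebra axioms for actions plus $\neg(0=1)$; equality axioms; substitution $\alpha=\beta\to(\varphi\to\varphi^\beta_\alpha)$; $\mathsf{P}(\alpha\sqcup\beta)\leftrightarrow(\mathsf{P}(\alpha)\wedge\mathsf{P}(\beta))$; $\mathsf{F}(\alpha\sqcup\beta)\leftrightarrow(\mathsf{F}(\alpha)\wedge\mathsf{F}(\beta))$; $\alpha=0\leftrightarrow(\mathsf{P}(\alpha)\wedge\mathsf{F}(\alpha))$. $\mathrm{Cn}(\Phi)=\{\varphi:\Phi\vdash\varphi\}$; $\Phi$ is $\vdash$-consistent iff $\Phi\not\vdash\bot$. A basic deontic default is a normal default $\frac{\mathsf{P}(\alpha):\mathsf{P}(\beta)}{\mathsf{P}(\beta)}$ or $\frac{\mathsf{F}(\alpha):\mathsf{F}(\beta)}{\mathsf{F}(\beta)}$.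 Lindenbaum–Tarski algebra: $\alpha\equiv_\Phi\beta$ iff $(\alpha=\beta)\in\mathrm{Cn}(\Phi)$; $[\alpha]_\Phi$ is the class of $\alpha$; $\mathbf{L}_\Phi$ is the Boolean algebra on the classes with $[\alpha]+[\beta]=[\alpha\sqcup\beta]$, $[\alpha]\cdot[\beta]=[\alpha\sqcap\beta]$, $-[\alpha]=[\overline\alpha]$, $0=[0]_\Phi$, $1=[1]_\Phi$, and order $x\sqsubseteq y$ iff $x=x\cdot y$. An ideal is a subset closed under $+$ and under $\cdot$ with arbitrary elements; $(S)$ denotes the ideal generated by $S$ (intersection of all ideals containing $S$). $P_{\mathbf{L}_\Phi}$ is the smallest ideal containing $[\alpha]_\Phi$ for every $\alpha$ with $\mathsf{P}(\alpha)\in\mathrm{Cn}(\Phi)$; $F_{\mathbf{L}_\Phi}$ likewise with $\mathsf{F}$. Deontic duals: $P^{\partial}=\{[\beta]_\Phi : \exists\alpha,\ \neg\mathsf{P}(\alpha)\in\mathrm{Cn}(\Phi),\ [\beta]_\Phi\sqsubseteq[\alpha]_\Phi\}\setminus P_{\mathbf{L}_\Phi}$ and $F^{\partial}=\{[\beta]_\Phi : \exists\alpha,\ \neg\mathsf{F}(\alpha)\in\mathrm{Cn}(\Phi),\ [\beta]_\Phi\sqsubseteq[\alpha]_\Phi\}\setminus F_{\mathbf{L}_\Phi}$. Write $[\beta]_\Phi\preccurlyeq P^\partial$ iff some $[\gamma]_\Phi\sqsubseteq[\beta]_\Phi$ lies in $P^\partial$ (similarly for $F^\partial$). Algebraic extension: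 $E^\Delta_\Phi$ maps a pair of ideals $(P,F)$ of $\mathbf{L}_\Phi$ to $(P',F')$, where $P',F'$ are the smallest ideals satisfying: (i) $P_{\mathbf{L}_\Phi}\subseteq P'$ and $F_{\mathbf{L}_\Phi}\subseteq F'$; (ii) for every $\frac{\mathsf{P}(\alpha):\mathsf{P}(\beta)}{\mathsf{P}(\beta)}\in\Delta$, if $[\alpha]_\Phi\in P'$, $(P'\cup\{[\beta]_\Phi\})\cap F'=\{[0]_\Phi\}$ and not $[\beta]_\Phi\preccurlyeq P^\partial$, then $[\beta]_\Phi\in P'$; (iii) for every $\frac{\mathsf{F}(\alpha):\mathsf{F}(\beta)}{\mathsf{F}(\beta)}\in\Delta$, if $[\alpha]_\Phi\in F'$, $(F'\cup\{[\beta]_\Phi\})\cap P'=\{[0]_\Phi\}$ and not $[\beta]_\Phi\preccurlyeq F^\partial$, then $[\beta]_\Phi\in F'$. $(P,F)$ is an algebraic extension of $\Phi$ under $\Delta$ iff $(P,F)=E^\Delta_\Phi(P,F)$.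
   Formalization: In (ii) and (iii) the consistency test uses the argument (P,F) of E instead of (P',F'), since with primes throughout a smallest pair need not exist (Φ=∅, defaults P(0):P(a) and F(0):F(a)); (P∪{[β]}) is read as the generated ideal. *)

theory Defs
  imports Main
begin

section \<open>Deontic action logic\<close>

datatype action =
    Basic nat
  | Join action action  (infixl \<open>\<squnion>\<^sub>a\<close> 65)
  | Meet action action  (infixl \<open>\<sqinter>\<^sub>a\<close> 70)
  | Compl action
  | Zero  (\<open>0\<^sub>a\<close>)
  | One  (\<open>1\<^sub>a\<close>)

datatype fm =
    Neg fm
  | Disj fm fm
  | Eq action action  (infix \<open>=\<^sub>a\<close> 50)
  | Perm action
  | Forb action

definition Imp :: "fm \<Rightarrow> fm \<Rightarrow> fm" (infixr \<open>\<longrightarrow>\<^sub>f\<close> 25) where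
  "Imp \<phi> \<psi> = Disj (Neg \<phi>) \<psi>"

definition Conj :: "fm \<Rightarrow> fm \<Rightarrow> fm" (infixr \<open>\<and>\<^sub>f\<close> 35) where
  "Conj \<phi> \<psi> = Neg (Disj (Neg \<phi>) (Neg \<psi>))"

definition Iff :: "fm \<Rightarrow> fm \<Rightarrow> fm" (infixr \<open>\<longleftrightarrow>\<^sub>f\<close> 25) where
  "Iff \<phi> \<psi> = Conj (Imp \<phi> \<psi>) (Imp \<psi> \<phi>)"

definition Falsum :: fm (\<open>\<bottom>\<^sub>f\<close>) where
  "Falsum = Conj (0\<^sub>a =\<^sub>a 0\<^sub>a) (Neg (0\<^sub>a =\<^sub>a 0\<^sub>a))"

text \<open>\<open>repl_act \<alpha> \<beta> \<gamma>\<close> and \<open>repl_fm \<alpha> \<beta> \<phi>\<close> replace every (outermost) occurrence of the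
  action term \<open>\<alpha>\<close>, which need not be a basic action, by \<open>\<beta>\<close>. As the congruence laws are among
  the equality axioms below, replacing only some of the occurrences gives the same provability
  relation.\<close>

primrec repl_act :: "action \<Rightarrow> action \<Rightarrow> action \<Rightarrow> action" where
  "repl_act \<alpha> \<beta> (Basic n) = (if Basic n = \<alpha> then \<beta> else Basic n)"
| "repl_act \<alpha> \<beta> (\<gamma> \<squnion>\<^sub>a \<delta>) =
     (if \<gamma> \<squnion>\<^sub>a \<delta> = \<alpha> then \<beta> else repl_act \<alpha> \<beta> \<gamma> \<squnion>\<^sub>a repl_act \<alpha> \<beta> \<delta>)"
| "repl_act \<alpha> \<beta> (\<gamma> \<sqinter>\<^sub>a \<delta>) =
     (if \<gamma> \<sqinter>\<^sub>a \<delta> = \<alpha> then \<beta> else repl_act \<alpha> \<beta> \<gamma> \<sqinter>\<^sub>a repl_act \<alpha> \<beta> \<delta>)"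
| "repl_act \<alpha> \<beta> (Compl \<gamma>) = (if Compl \<gamma> = \<alpha> then \<beta> else Compl (repl_act \<alpha> \<beta> \<gamma>))"
| "repl_act \<alpha> \<beta> 0\<^sub>a = (if 0\<^sub>a = \<alpha> then \<beta> else 0\<^sub>a)"
| "repl_act \<alpha> \<beta> 1\<^sub>a = (if 1\<^sub>a = \<alpha> then \<beta> else 1\<^sub>a)"

primrec repl_fm :: "action \<Rightarrow> action \<Rightarrow> fm \<Rightarrow> fm" where
  "repl_fm \<alpha> \<beta> (Neg \<phi>) = Neg (repl_fm \<alpha> \<beta> \<phi>)"
| "repl_fm \<alpha> \<beta> (Disj \<phi> \<psi>) = Disj (repl_fm \<alpha> \<beta> \<phi>) (repl_fm \<alpha> \<beta> \<psi>)"
| "repl_fm \<alpha> \<beta> (\<gamma> =\<^sub>a \<delta>) = (repl_act \<alpha> \<beta> \<gamma> =\<^sub>a repl_act \<alpha> \<beta> \<delta>)"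
| "repl_fm \<alpha> \<beta> (Perm \<gamma>) = Perm (repl_act \<alpha> \<beta> \<gamma>)"
| "repl_fm \<alpha> \<beta> (Forb \<gamma>) = Forb (repl_act \<alpha> \<beta> \<gamma>)"

inductive dal_axiom :: "fm \<Rightarrow> bool" where
  prop_K: "dal_axiom (\<phi> \<longrightarrow>\<^sub>f \<psi> \<longrightarrow>\<^sub>f \<phi>)"
| prop_S: "dal_axiom ((\<phi> \<longrightarrow>\<^sub>f \<psi> \<longrightarrow>\<^sub>f \<chi>) \<longrightarrow>\<^sub>f (\<phi> \<longrightarrow>\<^sub>f \<psi>) \<longrightarrow>\<^sub>f \<phi> \<longrightarrow>\<^sub>f \<chi>)"
| prop_contrapos: "dal_axiom ((Neg \<phi> \<longrightarrow>\<^sub>f Neg \<psi>) \<longrightarrow>\<^sub>f \<psi> \<longrightarrow>\<^sub>f \<phi>)"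
| prop_disjI1: "dal_axiom (\<phi> \<longrightarrow>\<^sub>f Disj \<phi> \<psi>)"
| prop_disjI2: "dal_axiom (\<psi> \<longrightarrow>\<^sub>f Disj \<phi> \<psi>)"
| prop_disjE: "dal_axiom ((\<phi> \<longrightarrow>\<^sub>f \<chi>) \<longrightarrow>\<^sub>f (\<psi> \<longrightarrow>\<^sub>f \<chi>) \<longrightarrow>\<^sub>f Disj \<phi> \<psi> \<longrightarrow>\<^sub>f \<chi>)"
| ba_join_comm: "dal_axiom (\<alpha> \<squnion>\<^sub>a \<beta> =\<^sub>a \<beta> \<squnion>\<^sub>a \<alpha>)"
| ba_meet_comm: "dal_axiom (\<alpha> \<sqinter>\<^sub>a \<beta> =\<^sub>a \<beta> \<sqinter>\<^sub>a \<alpha>)"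
| ba_join_assoc: "dal_axiom (\<alpha> \<squnion>\<^sub>a (\<beta> \<squnion>\<^sub>a \<gamma>) =\<^sub>a (\<alpha> \<squnion>\<^sub>a \<beta>) \<squnion>\<^sub>a \<gamma>)"
| ba_meet_assoc: "dal_axiom (\<alpha> \<sqinter>\<^sub>a (\<beta> \<sqinter>\<^sub>a \<gamma>) =\<^sub>a (\<alpha> \<sqinter>\<^sub>a \<beta>) \<sqinter>\<^sub>a \<gamma>)"
| ba_join_absorb: "dal_axiom (\<alpha> \<squnion>\<^sub>a (\<alpha> \<sqinter>\<^sub>a \<beta>) =\<^sub>a \<alpha>)"
| ba_meet_absorb: "dal_axiom (\<alpha> \<sqinter>\<^sub>a (\<alpha> \<squnion>\<^sub>a \<beta>) =\<^sub>a \<alpha>)"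
| ba_join_distrib: "dal_axiom (\<alpha> \<squnion>\<^sub>a (\<beta> \<sqinter>\<^sub>a \<gamma>) =\<^sub>a (\<alpha> \<squnion>\<^sub>a \<beta>) \<sqinter>\<^sub>a (\<alpha> \<squnion>\<^sub>a \<gamma>))"
| ba_meet_distrib: "dal_axiom (\<alpha> \<sqinter>\<^sub>a (\<beta> \<squnion>\<^sub>a \<gamma>) =\<^sub>a (\<alpha> \<sqinter>\<^sub>a \<beta>) \<squnion>\<^sub>a (\<alpha> \<sqinter>\<^sub>a \<gamma>))"
| ba_join_zero: "dal_axiom (\<alpha> \<squnion>\<^sub>a 0\<^sub>a =\<^sub>a \<alpha>)"
| ba_meet_one: "dal_axiom (\<alpha> \<sqinter>\<^sub>a 1\<^sub>a =\<^sub>a \<alpha>)"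
| ba_join_compl: "dal_axiom (\<alpha> \<squnion>\<^sub>a Compl \<alpha> =\<^sub>a 1\<^sub>a)"
| ba_meet_compl: "dal_axiom (\<alpha> \<sqinter>\<^sub>a Compl \<alpha> =\<^sub>a 0\<^sub>a)"
| ba_nontrivial: "dal_axiom (Neg (0\<^sub>a =\<^sub>a 1\<^sub>a))"
| eq_refl: "dal_axiom (\<alpha> =\<^sub>a \<alpha>)"
| eq_sym: "dal_axiom (\<alpha> =\<^sub>a \<beta> \<longrightarrow>\<^sub>f \<beta> =\<^sub>a \<alpha>)"
| eq_trans: "dal_axiom (\<alpha> =\<^sub>a \<beta> \<longrightarrow>\<^sub>f \<beta> =\<^sub>a \<gamma> \<longrightarrow>\<^sub>f \<alpha> =\<^sub>a \<gamma>)"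
| eq_join: "dal_axiom (\<alpha> =\<^sub>a \<beta> \<longrightarrow>\<^sub>f \<gamma> =\<^sub>a \<delta> \<longrightarrow>\<^sub>f \<alpha> \<squnion>\<^sub>a \<gamma> =\<^sub>a \<beta> \<squnion>\<^sub>a \<delta>)"
| eq_meet: "dal_axiom (\<alpha> =\<^sub>a \<beta> \<longrightarrow>\<^sub>f \<gamma> =\<^sub>a \<delta> \<longrightarrow>\<^sub>f \<alpha> \<sqinter>\<^sub>a \<gamma> =\<^sub>a \<beta> \<sqinter>\<^sub>a \<delta>)"
| eq_compl: "dal_axiom (\<alpha> =\<^sub>a \<beta> \<longrightarrow>\<^sub>f Compl \<alpha> =\<^sub>a Compl \<beta>)"
| subst: "dal_axiom (\<alpha> =\<^sub>a \<beta> \<longrightarrow>\<^sub>f \<phi> \<longrightarrow>\<^sub>f repl_fm \<alpha> \<beta> \<phi>)"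
| perm_join: "dal_axiom (Perm (\<alpha> \<squnion>\<^sub>a \<beta>) \<longleftrightarrow>\<^sub>f (Perm \<alpha> \<and>\<^sub>f Perm \<beta>))"
| forb_join: "dal_axiom (Forb (\<alpha> \<squnion>\<^sub>a \<beta>) \<longleftrightarrow>\<^sub>f (Forb \<alpha> \<and>\<^sub>f Forb \<beta>))"
| zero_perm_forb: "dal_axiom (\<alpha> =\<^sub>a 0\<^sub>a \<longleftrightarrow>\<^sub>f (Perm \<alpha> \<and>\<^sub>f Forb \<alpha>))"

inductive proves :: "fm set \<Rightarrow> fm \<Rightarrow> bool" (infix \<open>\<turnstile>\<close> 20) for \<Phi> :: "fm set" where
  ax: "dal_axiom \<phi> \<Longrightarrow> \<Phi> \<turnstile> \<phi>"
| assm: "\<phi> \<in> \<Phi> \<Longrightarrow> \<Phi> \<turnstile> \<phi>"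
| mp: "\<Phi> \<turnstile> (\<phi> \<longrightarrow>\<^sub>f \<psi>) \<Longrightarrow> \<Phi> \<turnstile> \<phi> \<Longrightarrow> \<Phi> \<turnstile> \<psi>"

definition Cn :: "fm set \<Rightarrow> fm set" where
  "Cn \<Phi> = {\<phi>. \<Phi> \<turnstile> \<phi>}"

definition consistent :: "fm set \<Rightarrow> bool" where
  "consistent \<Phi> \<longleftrightarrow> \<not> (\<Phi> \<turnstile> \<bottom>\<^sub>f)"

text \<open>\<open>PermD \<alpha> \<beta>\<close> is the normal default with prerequisite \<open>Perm \<alpha>\<close> and with justification and
  consequent \<open>Perm \<beta>\<close>; similarly for \<open>ForbD\<close>.\<close>

datatype deontic_default = PermD action action | ForbD action action


section \<open>The Lindenbaum--Tarski algebra\<close>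

definition lt_rel :: "fm set \<Rightarrow> (action \<times> action) set" where
  "lt_rel \<Phi> = {(\<alpha>, \<beta>). (\<alpha> =\<^sub>a \<beta>) \<in> Cn \<Phi>}"

definition cls :: "fm set \<Rightarrow> action \<Rightarrow> action set" where
  "cls \<Phi> \<alpha> = lt_rel \<Phi> `` {\<alpha>}"

definition lt_carrier :: "fm set \<Rightarrow> action set set" where
  "lt_carrier \<Phi> = UNIV // lt_rel \<Phi>"

text \<open>The operations on classes are given as unions over representatives; on classes of actions
  they are computed by the lemmas \<open>lt_join_cls\<close>, \<open>lt_meet_cls\<close> and \<open>lt_compl_cls\<close> below.\<close>

definition lt_join :: "fm set \<Rightarrow> action set \<Rightarrow> action set \<Rightarrow> action set" where
  "lt_join \<Phi> x y = (\<Union>\<alpha>\<in>x. \<Union>\<beta>\<in>y. cls \<Phi> (\<alpha> \<squnion>\<^sub>a \<beta>))"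

definition lt_meet :: "fm set \<Rightarrow> action set \<Rightarrow> action set \<Rightarrow> action set" where
  "lt_meet \<Phi> x y = (\<Union>\<alpha>\<in>x. \<Union>\<beta>\<in>y. cls \<Phi> (\<alpha> \<sqinter>\<^sub>a \<beta>))"

definition lt_compl :: "fm set \<Rightarrow> action set \<Rightarrow> action set" where
  "lt_compl \<Phi> x = (\<Union>\<alpha>\<in>x. cls \<Phi> (Compl \<alpha>))"

definition lt_le :: "fm set \<Rightarrow> action set \<Rightarrow> action set \<Rightarrow> bool" where
  "lt_le \<Phi> x y \<longleftrightarrow> x = lt_meet \<Phi> x y"

definition lt_ideal :: "fm set \<Rightarrow> action set set \<Rightarrow> bool" where
  "lt_ideal \<Phi> I \<longleftrightarrow> I \<subseteq> lt_carrier \<Phi> \<and>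
     (\<forall>x\<in>I. \<forall>y\<in>I. lt_join \<Phi> x y \<in> I) \<and>
     (\<forall>x\<in>I. \<forall>y\<in>lt_carrier \<Phi>. lt_meet \<Phi> x y \<in> I)"

definition gen_ideal :: "fm set \<Rightarrow> action set set \<Rightarrow> action set set" where
  "gen_ideal \<Phi> S = \<Inter> {I. lt_ideal \<Phi> I \<and> S \<subseteq> I}"

definition P_ideal :: "fm set \<Rightarrow> action set set" where
  "P_ideal \<Phi> = gen_ideal \<Phi> {cls \<Phi> \<alpha> | \<alpha>. Perm \<alpha> \<in> Cn \<Phi>}"

definition F_ideal :: "fm set \<Rightarrow> action set set" where
  "F_ideal \<Phi> = gen_ideal \<Phi> {cls \<Phi> \<alpha> | \<alpha>. Forb \<alpha> \<in> Cn \<Phi>}"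

definition P_dual :: "fm set \<Rightarrow> action set set" where
  "P_dual \<Phi> =
     {cls \<Phi> \<beta> | \<beta>. \<exists>\<alpha>. Neg (Perm \<alpha>) \<in> Cn \<Phi> \<and> lt_le \<Phi> (cls \<Phi> \<beta>) (cls \<Phi> \<alpha>)} - P_ideal \<Phi>"

definition F_dual :: "fm set \<Rightarrow> action set set" where
  "F_dual \<Phi> =
     {cls \<Phi> \<beta> | \<beta>. \<exists>\<alpha>. Neg (Forb \<alpha>) \<in> Cn \<Phi> \<and> lt_le \<Phi> (cls \<Phi> \<beta>) (cls \<Phi> \<alpha>)} - F_ideal \<Phi>"

text \<open>\<open>above \<Phi> x D\<close> is the relation that holds when some element of \<open>D\<close> lies below \<open>x\<close>.\<close>

definition above :: "fm set \<Rightarrow> action set \<Rightarrow> action set set \<Rightarrow> bool" where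
  "above \<Phi> x D \<longleftrightarrow> (\<exists>\<gamma>. lt_le \<Phi> (cls \<Phi> \<gamma>) x \<and> cls \<Phi> \<gamma> \<in> D)"


section \<open>Algebraic extensions\<close>

text \<open>The clauses defining the value \<open>(P', F')\<close> of the extension operator at \<open>(P, F)\<close>. As usual
  for default logic, prerequisites are looked up in the value \<open>(P', F')\<close>, while the consistency
  of the justification is tested against the argument \<open>(P, F)\<close>; at a fixed point the two pairs
  coincide. (Testing it against \<open>(P', F')\<close> as well would make the operator independent of its
  argument, and a least \<open>(P', F')\<close> would in general not exist; see
  \<open>algebraic_extension_minimal\<close> below for the relation to that variant.)
  In the test, the ideal generated by \<open>P\<close> and the class of \<open>\<beta>\<close> is intersected with \<open>F\<close>.\<close>

definition ext_closed ::
  "fm set \<Rightarrow> deontic_default set \<Rightarrow> action set set \<Rightarrow> action set set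
    \<Rightarrow> action set set \<Rightarrow> action set set \<Rightarrow> bool" where
  "ext_closed \<Phi> \<Delta> P F P' F' \<longleftrightarrow>
     lt_ideal \<Phi> P' \<and> lt_ideal \<Phi> F' \<and>
     P_ideal \<Phi> \<subseteq> P' \<and> F_ideal \<Phi> \<subseteq> F' \<and>
     (\<forall>\<alpha> \<beta>. PermD \<alpha> \<beta> \<in> \<Delta> \<longrightarrow> cls \<Phi> \<alpha> \<in> P' \<longrightarrow>
        gen_ideal \<Phi> (P \<union> {cls \<Phi> \<beta>}) \<inter> F = {cls \<Phi> 0\<^sub>a} \<longrightarrow>
        \<not> above \<Phi> (cls \<Phi> \<beta>) (P_dual \<Phi>) \<longrightarrow> cls \<Phi> \<beta> \<in> P') \<and>
     (\<forall>\<alpha> \<beta>. ForbD \<alpha> \<beta> \<in> \<Delta> \<longrightarrow> cls \<Phi> \<alpha> \<in> F' \<longrightarrow>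
        gen_ideal \<Phi> (F \<union> {cls \<Phi> \<beta>}) \<inter> P = {cls \<Phi> 0\<^sub>a} \<longrightarrow>
        \<not> above \<Phi> (cls \<Phi> \<beta>) (F_dual \<Phi>) \<longrightarrow> cls \<Phi> \<beta> \<in> F')"

definition ext_least ::
  "fm set \<Rightarrow> deontic_default set \<Rightarrow> action set set \<Rightarrow> action set set
    \<Rightarrow> action set set \<Rightarrow> action set set \<Rightarrow> bool" where
  "ext_least \<Phi> \<Delta> P F P' F' \<longleftrightarrow>
     ext_closed \<Phi> \<Delta> P F P' F' \<and>
     (\<forall>Q G. ext_closed \<Phi> \<Delta> P F Q G \<longrightarrow> P' \<subseteq> Q \<and> F' \<subseteq> G)"

definition ext_op ::
  "fm set \<Rightarrow> deontic_default set \<Rightarrow> action set set \<times> action set set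
    \<Rightarrow> action set set \<times> action set set" where
  "ext_op \<Phi> \<Delta> = (\<lambda>(P, F). THE (P', F'). ext_least \<Phi> \<Delta> P F P' F')"

definition algebraic_extension ::
  "fm set \<Rightarrow> deontic_default set \<Rightarrow> action set set \<times> action set set \<Rightarrow> bool" where
  "algebraic_extension \<Phi> \<Delta> = (\<lambda>(P, F).
     lt_ideal \<Phi> P \<and> lt_ideal \<Phi> F \<and> (P, F) = ext_op \<Phi> \<Delta> (P, F))"


section \<open>Well-definedness\<close>

lemma equiv_lt_rel: "equiv UNIV (lt_rel \<Phi>)"
proof (rule equivI)
  show "refl (lt_rel \<Phi>)"
    by (auto simp: refl_on_def lt_rel_def Cn_def intro: proves.ax dal_axiom.eq_refl)
  show "sym (lt_rel \<Phi>)"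
    by (auto simp: sym_def lt_rel_def Cn_def
        intro: proves.mp[OF proves.ax[OF dal_axiom.eq_sym]])
  show "trans (lt_rel \<Phi>)"
    unfolding trans_def lt_rel_def Cn_def
    using proves.mp[OF proves.mp[OF proves.ax[OF dal_axiom.eq_trans]]] by blast
qed auto

lemma cls_eq_iff: "cls \<Phi> \<alpha> = cls \<Phi> \<beta> \<longleftrightarrow> (\<Phi> \<turnstile> \<alpha> =\<^sub>a \<beta>)"
  unfolding cls_def using equiv_class_eq_iff[OF equiv_lt_rel[of \<Phi>], of \<alpha> \<beta>]
  by (simp add: lt_rel_def Cn_def)

lemma in_cls_iff: "\<beta> \<in> cls \<Phi> \<alpha> \<longleftrightarrow> (\<Phi> \<turnstile> \<alpha> =\<^sub>a \<beta>)"
  by (simp add: cls_def lt_rel_def Cn_def)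

lemma cls_self: "\<alpha> \<in> cls \<Phi> \<alpha>"
  by (simp add: in_cls_iff proves.ax dal_axiom.eq_refl)

lemma lt_carrier_eq: "lt_carrier \<Phi> = range (cls \<Phi>)"
  by (auto simp: lt_carrier_def quotient_def cls_def)

lemma lt_join_cls: "lt_join \<Phi> (cls \<Phi> \<alpha>) (cls \<Phi> \<beta>) = cls \<Phi> (\<alpha> \<squnion>\<^sub>a \<beta>)"
proof -
  have "cls \<Phi> (\<gamma> \<squnion>\<^sub>a \<delta>) = cls \<Phi> (\<alpha> \<squnion>\<^sub>a \<beta>)" if "\<gamma> \<in> cls \<Phi> \<alpha>" "\<delta> \<in> cls \<Phi> \<beta>" for \<gamma> \<delta>
    by (rule sym, unfold cls_eq_iff,
        rule proves.mp[OF proves.mp[OF proves.ax[OF dal_axiom.eq_join]]])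
      (use that in \<open>simp_all only: in_cls_iff\<close>)
  moreover have "cls \<Phi> \<alpha> \<noteq> {}" "cls \<Phi> \<beta> \<noteq> {}" using cls_self by blast+
  ultimately show ?thesis unfolding lt_join_def by (intro SUP_eq_const)
qed

lemma lt_meet_cls: "lt_meet \<Phi> (cls \<Phi> \<alpha>) (cls \<Phi> \<beta>) = cls \<Phi> (\<alpha> \<sqinter>\<^sub>a \<beta>)"
proof -
  have "cls \<Phi> (\<gamma> \<sqinter>\<^sub>a \<delta>) = cls \<Phi> (\<alpha> \<sqinter>\<^sub>a \<beta>)" if "\<gamma> \<in> cls \<Phi> \<alpha>" "\<delta> \<in> cls \<Phi> \<beta>" for \<gamma> \<delta>
    by (rule sym, unfold cls_eq_iff,
        rule proves.mp[OF proves.mp[OF proves.ax[OF dal_axiom.eq_meet]]])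
      (use that in \<open>simp_all only: in_cls_iff\<close>)
  moreover have "cls \<Phi> \<alpha> \<noteq> {}" "cls \<Phi> \<beta> \<noteq> {}" using cls_self by blast+
  ultimately show ?thesis unfolding lt_meet_def by (intro SUP_eq_const)
qed

lemma lt_compl_cls: "lt_compl \<Phi> (cls \<Phi> \<alpha>) = cls \<Phi> (Compl \<alpha>)"
proof -
  have "cls \<Phi> (Compl \<gamma>) = cls \<Phi> (Compl \<alpha>)" if "\<gamma> \<in> cls \<Phi> \<alpha>" for \<gamma>
    by (rule sym, unfold cls_eq_iff, rule proves.mp[OF proves.ax[OF dal_axiom.eq_compl]])
      (use that in \<open>simp only: in_cls_iff\<close>)
  moreover have "cls \<Phi> \<alpha> \<noteq> {}" using cls_self by blast
  ultimately show ?thesis unfolding lt_compl_def by (intro SUP_eq_const)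
qed

lemma lt_ideal_carrier: "lt_ideal \<Phi> (lt_carrier \<Phi>)"
  unfolding lt_ideal_def lt_carrier_eq by (auto simp: lt_join_cls lt_meet_cls)

lemma lt_ideal_Inter:
  assumes "\<I> \<noteq> {}" "\<And>I. I \<in> \<I> \<Longrightarrow> lt_ideal \<Phi> I"
  shows "lt_ideal \<Phi> (\<Inter>\<I>)"
  using assms unfolding lt_ideal_def by blast

lemma gen_ideal_mono: "S \<subseteq> T \<Longrightarrow> gen_ideal \<Phi> S \<subseteq> gen_ideal \<Phi> T"
  unfolding gen_ideal_def by blast

lemma gen_ideal_superset: "S \<subseteq> gen_ideal \<Phi> S"
  unfolding gen_ideal_def by blast

lemma gen_ideal_least: "lt_ideal \<Phi> I \<Longrightarrow> S \<subseteq> I \<Longrightarrow> gen_ideal \<Phi> S \<subseteq> I"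
  unfolding gen_ideal_def by blast

lemma ext_closed_base:
  assumes "ext_closed \<Phi> \<Delta> P F P' F'"
  shows "lt_ideal \<Phi> P'" "lt_ideal \<Phi> F'" "P_ideal \<Phi> \<subseteq> P'" "F_ideal \<Phi> \<subseteq> F'"
  using assms by (simp_all add: ext_closed_def)

lemma ext_closed_PermD:
  "ext_closed \<Phi> \<Delta> P F P' F' \<Longrightarrow> PermD \<alpha> \<beta> \<in> \<Delta> \<Longrightarrow> cls \<Phi> \<alpha> \<in> P' \<Longrightarrow>
   gen_ideal \<Phi> (P \<union> {cls \<Phi> \<beta>}) \<inter> F = {cls \<Phi> 0\<^sub>a} \<Longrightarrow>
   \<not> above \<Phi> (cls \<Phi> \<beta>) (P_dual \<Phi>) \<Longrightarrow> cls \<Phi> \<beta> \<in> P'"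
  by (simp add: ext_closed_def)

lemma ext_closed_ForbD:
  "ext_closed \<Phi> \<Delta> P F P' F' \<Longrightarrow> ForbD \<alpha> \<beta> \<in> \<Delta> \<Longrightarrow> cls \<Phi> \<alpha> \<in> F' \<Longrightarrow>
   gen_ideal \<Phi> (F \<union> {cls \<Phi> \<beta>}) \<inter> P = {cls \<Phi> 0\<^sub>a} \<Longrightarrow>
   \<not> above \<Phi> (cls \<Phi> \<beta>) (F_dual \<Phi>) \<Longrightarrow> cls \<Phi> \<beta> \<in> F'"
  by (simp add: ext_closed_def)

lemma ext_least_unique:
  "ext_least \<Phi> \<Delta> P F P1 F1 \<Longrightarrow> ext_least \<Phi> \<Delta> P F P2 F2 \<Longrightarrow> P1 = P2 \<and> F1 = F2"
  unfolding ext_least_def by blast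

lemma ext_least_exists: "\<exists>P' F'. ext_least \<Phi> \<Delta> P F P' F'"
proof -
  define C where "C = ext_closed \<Phi> \<Delta> P F"
  let ?P = "\<Inter> {Q. \<exists>G. C Q G}" and ?F = "\<Inter> {G. \<exists>Q. C Q G}"
  note C_base = ext_closed_base[of \<Phi> \<Delta> P F, folded C_def]
  have sub: "gen_ideal \<Phi> S \<subseteq> lt_carrier \<Phi>" if "S \<subseteq> lt_carrier \<Phi>" for S
    using gen_ideal_least[OF lt_ideal_carrier that] .
  have cls: "cls \<Phi> \<alpha> \<in> lt_carrier \<Phi>" for \<alpha> by (simp add: lt_carrier_eq)
  have "P_ideal \<Phi> \<subseteq> lt_carrier \<Phi>" "F_ideal \<Phi> \<subseteq> lt_carrier \<Phi>"
    unfolding P_ideal_def F_ideal_def by (rule sub, use cls in blast)+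
  then have ne: "C (lt_carrier \<Phi>) (lt_carrier \<Phi>)"
    by (simp add: C_def ext_closed_def lt_ideal_carrier cls)
  have ideals: "lt_ideal \<Phi> ?P" "lt_ideal \<Phi> ?F"
    by (rule lt_ideal_Inter, use ne in blast, use C_base(1,2) in blast)+
  have "ext_closed \<Phi> \<Delta> P F ?P ?F"
    unfolding ext_closed_def[of \<Phi> \<Delta> P F ?P ?F]
  proof (intro conjI allI impI ideals)
    show "P_ideal \<Phi> \<subseteq> ?P" "F_ideal \<Phi> \<subseteq> ?F"
      using C_base(3,4) by blast+
  next
    fix \<alpha> \<beta>
    assume "PermD \<alpha> \<beta> \<in> \<Delta>" "cls \<Phi> \<alpha> \<in> ?P"
      "gen_ideal \<Phi> (P \<union> {cls \<Phi> \<beta>}) \<inter> F = {cls \<Phi> 0\<^sub>a}" "\<not> above \<Phi> (cls \<Phi> \<beta>) (P_dual \<Phi>)"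
    then show "cls \<Phi> \<beta> \<in> ?P"
      using ext_closed_PermD[of \<Phi> \<Delta> P F _ _ \<alpha> \<beta>, folded C_def] by simp metis
  next
    fix \<alpha> \<beta>
    assume "ForbD \<alpha> \<beta> \<in> \<Delta>" "cls \<Phi> \<alpha> \<in> ?F"
      "gen_ideal \<Phi> (F \<union> {cls \<Phi> \<beta>}) \<inter> P = {cls \<Phi> 0\<^sub>a}" "\<not> above \<Phi> (cls \<Phi> \<beta>) (F_dual \<Phi>)"
    then show "cls \<Phi> \<beta> \<in> ?F"
      using ext_closed_ForbD[of \<Phi> \<Delta> P F _ _ \<alpha> \<beta>, folded C_def] by simp metis
  qed
  then have "ext_least \<Phi> \<Delta> P F ?P ?F"
    unfolding ext_least_def C_def[symmetric] by blast
  then show ?thesis by blast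
qed

lemma ext_op_eq_iff: "ext_op \<Phi> \<Delta> (P, F) = (P', F') \<longleftrightarrow> ext_least \<Phi> \<Delta> P F P' F'"
proof -
  obtain P1 F1 where 1: "ext_least \<Phi> \<Delta> P F P1 F1" using ext_least_exists by blast
  have "ext_op \<Phi> \<Delta> (P, F) = (P1, F1)"
    unfolding ext_op_def prod.case
  proof (rule the_equality)
    show "case (P1, F1) of (P', F') \<Rightarrow> ext_least \<Phi> \<Delta> P F P' F'" using 1 by simp
  next
    fix x assume "case x of (P', F') \<Rightarrow> ext_least \<Phi> \<Delta> P F P' F'"
    then have "ext_least \<Phi> \<Delta> P F (fst x) (snd x)" by (simp add: case_prod_unfold)
    from ext_least_unique[OF this 1] show "x = (P1, F1)" by (simp add: prod_eq_iff)
  qed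
  then show ?thesis using 1 by (metis Pair_inject ext_least_unique)
qed

lemma proves_conjD:
  assumes "\<Phi> \<turnstile> \<phi> \<and>\<^sub>f \<psi>"
  shows "\<Phi> \<turnstile> \<phi>" "\<Phi> \<turnstile> \<psi>"
proof -
  have K: "\<Phi> \<turnstile> (\<mu> \<longrightarrow>\<^sub>f \<nu>)" if "\<Phi> \<turnstile> \<nu>" for \<mu> \<nu>
    by (rule proves.mp[OF proves.ax[OF dal_axiom.prop_K] that])
  have tr: "\<Phi> \<turnstile> (\<mu> \<longrightarrow>\<^sub>f \<xi>)" if "\<Phi> \<turnstile> (\<mu> \<longrightarrow>\<^sub>f \<nu>)" "\<Phi> \<turnstile> (\<nu> \<longrightarrow>\<^sub>f \<xi>)" for \<mu> \<nu> \<xi>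
    using proves.mp[OF proves.mp[OF proves.ax[OF dal_axiom.prop_S] K[OF that(2)]] that(1)] .
  have contra: "\<Phi> \<turnstile> (\<nu> \<longrightarrow>\<^sub>f \<mu>)" if "\<Phi> \<turnstile> (Neg \<mu> \<longrightarrow>\<^sub>f Neg \<nu>)" for \<mu> \<nu>
    by (rule proves.mp[OF proves.ax[OF dal_axiom.prop_contrapos] that])
  have exfalso: "\<Phi> \<turnstile> (Neg \<mu> \<longrightarrow>\<^sub>f \<mu> \<longrightarrow>\<^sub>f \<nu>)" for \<mu> \<nu>
    using tr[OF proves.ax[OF dal_axiom.prop_K] proves.ax[OF dal_axiom.prop_contrapos]] .
  have idp: "\<Phi> \<turnstile> (\<mu> \<longrightarrow>\<^sub>f \<mu>)" for \<mu>
    using proves.mp[OF proves.mp[OF proves.ax[OF dal_axiom.prop_S[of \<mu> "\<mu> \<longrightarrow>\<^sub>f \<mu>" \<mu>]]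
          proves.ax[OF dal_axiom.prop_K]] proves.ax[OF dal_axiom.prop_K]] .
  let ?T = "\<phi> \<longrightarrow>\<^sub>f \<phi>"
  have neg_elim: "\<Phi> \<turnstile> \<mu>" if neg: "\<Phi> \<turnstile> Neg \<rho>" and imp: "\<Phi> \<turnstile> (Neg \<mu> \<longrightarrow>\<^sub>f \<rho>)" for \<mu> \<rho>
  proof -
    have "\<Phi> \<turnstile> (\<rho> \<longrightarrow>\<^sub>f Neg ?T)"
      using proves.mp[OF exfalso neg] .
    then have "\<Phi> \<turnstile> (Neg \<mu> \<longrightarrow>\<^sub>f Neg ?T)" by (rule tr[OF imp])
    then have "\<Phi> \<turnstile> (?T \<longrightarrow>\<^sub>f \<mu>)" by (rule contra)
    then show ?thesis by (rule proves.mp[OF _ idp])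
  qed
  have "\<Phi> \<turnstile> Neg (Disj (Neg \<phi>) (Neg \<psi>))"
    using assms by (simp add: Conj_def)
  from neg_elim[OF this proves.ax[OF dal_axiom.prop_disjI1]]
    neg_elim[OF this proves.ax[OF dal_axiom.prop_disjI2]]
  show "\<Phi> \<turnstile> \<phi>" "\<Phi> \<turnstile> \<psi>" .
qed

lemma zero_in_P_ideal: "cls \<Phi> 0\<^sub>a \<in> P_ideal \<Phi>"
  and zero_in_F_ideal: "cls \<Phi> 0\<^sub>a \<in> F_ideal \<Phi>"
proof -
  have "\<Phi> \<turnstile> (0\<^sub>a =\<^sub>a 0\<^sub>a \<longrightarrow>\<^sub>f (Perm 0\<^sub>a \<and>\<^sub>f Forb 0\<^sub>a))"
    using proves_conjD(1)[OF proves.ax[OF dal_axiom.zero_perm_forb, unfolded Iff_def]] .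
  then have "\<Phi> \<turnstile> Perm 0\<^sub>a \<and>\<^sub>f Forb 0\<^sub>a"
    by (rule proves.mp[OF _ proves.ax[OF dal_axiom.eq_refl]])
  from proves_conjD[OF this]
  show "cls \<Phi> 0\<^sub>a \<in> P_ideal \<Phi>" "cls \<Phi> 0\<^sub>a \<in> F_ideal \<Phi>"
    unfolding P_ideal_def F_ideal_def Cn_def by (auto intro!: subsetD[OF gen_ideal_superset])
qed

text \<open>An algebraic extension satisfies the clauses in the form in which both the prerequisite and
  the justification refer to the same pair, and it is minimal among the pairs that satisfy them
  in this form.\<close>

lemma algebraic_extension_minimal:
  assumes ext: "algebraic_extension \<Phi> \<Delta> (P, F)"
  shows "ext_closed \<Phi> \<Delta> P F P F"
    and "ext_closed \<Phi> \<Delta> Q G Q G \<Longrightarrow> Q \<subseteq> P \<Longrightarrow> G \<subseteq> F \<Longrightarrow> Q = P \<and> G = F"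
proof -
  have least: "ext_least \<Phi> \<Delta> P F P F"
    using ext ext_op_eq_iff[of \<Phi> \<Delta> P F P F] unfolding algebraic_extension_def by simp
  then show "ext_closed \<Phi> \<Delta> P F P F" by (simp add: ext_least_def)
  assume QG: "ext_closed \<Phi> \<Delta> Q G Q G" and sub: "Q \<subseteq> P" "G \<subseteq> F"
  have zero: "cls \<Phi> 0\<^sub>a \<in> Q" "cls \<Phi> 0\<^sub>a \<in> G"
    using ext_closed_base(3,4)[OF QG] zero_in_P_ideal zero_in_F_ideal by blast+
  have testP: "gen_ideal \<Phi> (Q \<union> {x}) \<inter> G = {cls \<Phi> 0\<^sub>a}"
    if "gen_ideal \<Phi> (P \<union> {x}) \<inter> F = {cls \<Phi> 0\<^sub>a}" for x
  proof -
    have "gen_ideal \<Phi> (Q \<union> {x}) \<subseteq> gen_ideal \<Phi> (P \<union> {x})"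
      by (rule gen_ideal_mono) (use sub in blast)
    then have "gen_ideal \<Phi> (Q \<union> {x}) \<inter> G \<subseteq> {cls \<Phi> 0\<^sub>a}" using that sub by blast
    moreover have "cls \<Phi> 0\<^sub>a \<in> gen_ideal \<Phi> (Q \<union> {x})"
      by (rule subsetD[OF gen_ideal_superset]) (use zero in simp)
    ultimately show ?thesis using zero by blast
  qed
  have testF: "gen_ideal \<Phi> (G \<union> {x}) \<inter> Q = {cls \<Phi> 0\<^sub>a}"
    if "gen_ideal \<Phi> (F \<union> {x}) \<inter> P = {cls \<Phi> 0\<^sub>a}" for x
  proof -
    have "gen_ideal \<Phi> (G \<union> {x}) \<subseteq> gen_ideal \<Phi> (F \<union> {x})"
      by (rule gen_ideal_mono) (use sub in blast)
    then have "gen_ideal \<Phi> (G \<union> {x}) \<inter> Q \<subseteq> {cls \<Phi> 0\<^sub>a}" using that sub by blast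
    moreover have "cls \<Phi> 0\<^sub>a \<in> gen_ideal \<Phi> (G \<union> {x})"
      by (rule subsetD[OF gen_ideal_superset]) (use zero in simp)
    ultimately show ?thesis using zero by blast
  qed
  have "ext_closed \<Phi> \<Delta> P F Q G"
    unfolding ext_closed_def[of \<Phi> \<Delta> P F Q G]
    using ext_closed_base[OF QG] ext_closed_PermD[OF QG _ _ testP]
      ext_closed_ForbD[OF QG _ _ testF] by simp
  then show "Q = P \<and> G = F"
    using least sub unfolding ext_least_def by blast
qed

end

theory Submission
  imports Defs
begin

text \<open>
  The test of an algebraic extension \<open>(P, F)\<close> is that of a normal default theory whose consistency
  condition is \<open>P \<inter> F = {0}\<close>. Call a pair grounded if it is contained in every pair that is
  closed under those defaults whose conclusions the pair already has. Groundedness passes to unions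
  of chains, because enlarging a pair enlarges its set of defaults, so Zorn's lemma gives a
  maximal consistent grounded pair. Maximality makes it closed under all defaults that pass the
  test, and groundedness makes it the least such pair.
  If the initial pair is already inconsistent, no default passes the test at it.
\<close>

text \<open>Membership of the conclusion in \<open>P\<close> or \<open>F\<close> replaces the test
  of \<open>ext_closed\<close>. For ideals with \<open>P \<inter> F\<close> equal to the zero class
  it implies the test, and unlike the test it is preserved when the pair grows.\<close>

definition fired_closed ::
  "fm set \<Rightarrow> deontic_default set \<Rightarrow> action set set \<Rightarrow> action set set
    \<Rightarrow> action set set \<Rightarrow> action set set \<Rightarrow> bool" where
  "fired_closed \<Phi> \<Delta> P F Q G \<longleftrightarrow>
     lt_ideal \<Phi> Q \<and> lt_ideal \<Phi> G \<and> P_ideal \<Phi> \<subseteq> Q \<and> F_ideal \<Phi> \<subseteq> G \<and>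
     (\<forall>\<alpha> \<beta>. PermD \<alpha> \<beta> \<in> \<Delta> \<longrightarrow> \<not> above \<Phi> (cls \<Phi> \<beta>) (P_dual \<Phi>) \<longrightarrow>
        cls \<Phi> \<beta> \<in> P \<longrightarrow> cls \<Phi> \<alpha> \<in> Q \<longrightarrow> cls \<Phi> \<beta> \<in> Q) \<and>
     (\<forall>\<alpha> \<beta>. ForbD \<alpha> \<beta> \<in> \<Delta> \<longrightarrow> \<not> above \<Phi> (cls \<Phi> \<beta>) (F_dual \<Phi>) \<longrightarrow>
        cls \<Phi> \<beta> \<in> F \<longrightarrow> cls \<Phi> \<alpha> \<in> G \<longrightarrow> cls \<Phi> \<beta> \<in> G)"

text \<open>For ideals above the initial ones, \<open>(P, F)\<close> is itself
  \<open>fired_closed\<close> relative to \<open>(P, F)\<close>, so groundedness says that it is the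
  least such pair: everything in it is derived from the initial pair by its own fired
  defaults.\<close>

definition grounded ::
  "fm set \<Rightarrow> deontic_default set \<Rightarrow> action set set \<Rightarrow> action set set \<Rightarrow> bool" where
  "grounded \<Phi> \<Delta> P F \<longleftrightarrow> (\<forall>Q G. fired_closed \<Phi> \<Delta> P F Q G \<longrightarrow> P \<subseteq> Q \<and> F \<subseteq> G)"

definition consistent_grounded ::
  "fm set \<Rightarrow> deontic_default set \<Rightarrow> action set set \<times> action set set \<Rightarrow> bool" where
  "consistent_grounded \<Phi> \<Delta> = (\<lambda>(P, F).
     lt_ideal \<Phi> P \<and> lt_ideal \<Phi> F \<and> P_ideal \<Phi> \<subseteq> P \<and> F_ideal \<Phi> \<subseteq> F \<and>
     P \<inter> F = {cls \<Phi> 0\<^sub>a} \<and> grounded \<Phi> \<Delta> P F)"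

definition pair_le :: "'a set \<times> 'b set \<Rightarrow> 'a set \<times> 'b set \<Rightarrow> bool" where
  "pair_le x y \<longleftrightarrow> fst x \<subseteq> fst y \<and> snd x \<subseteq> snd y"

lemma fired_closed_antimono:
  "fired_closed \<Phi> \<Delta> P' F' Q G \<Longrightarrow> P \<subseteq> P' \<Longrightarrow> F \<subseteq> F' \<Longrightarrow> fired_closed \<Phi> \<Delta> P F Q G"
  unfolding fired_closed_def by blast

lemma lt_ideal_gen_ideal:
  assumes "S \<subseteq> lt_carrier \<Phi>"
  shows "lt_ideal \<Phi> (gen_ideal \<Phi> S)"
  unfolding gen_ideal_def
  \<comment> \<open>The carrier is an ideal above \<open>S\<close>, so the intersected family is
    nonempty.\<close>
  by (rule lt_ideal_Inter) (use assms lt_ideal_carrier in blast)+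

lemma lt_ideal_gen_ideal_insert:
  "lt_ideal \<Phi> P \<Longrightarrow> lt_ideal \<Phi> (gen_ideal \<Phi> (P \<union> {cls \<Phi> \<beta>}))"
  by (rule lt_ideal_gen_ideal) (auto simp: lt_ideal_def lt_carrier_eq)

text \<open>Reduces the test for a conclusion already in the pair to the consistency of the
  pair.\<close>

lemma gen_ideal_absorb: "lt_ideal \<Phi> P \<Longrightarrow> x \<in> P \<Longrightarrow> gen_ideal \<Phi> (P \<union> {x}) = P"
  using gen_ideal_least[of \<Phi> P "P \<union> {x}"] gen_ideal_superset[of "P \<union> {x}" \<Phi>] by auto

lemma lt_ideal_P_ideal: "lt_ideal \<Phi> (P_ideal \<Phi>)"
  and lt_ideal_F_ideal: "lt_ideal \<Phi> (F_ideal \<Phi>)"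
  unfolding P_ideal_def F_ideal_def by (rule lt_ideal_gen_ideal, auto simp: lt_carrier_eq)+

text \<open>Only joins combine elements of different members, and the larger of two comparable
  members contains both elements.\<close>

lemma lt_ideal_Union_chain:
  assumes ideal: "\<And>I. I \<in> \<C> \<Longrightarrow> lt_ideal \<Phi> I"
    and chain: "\<And>I J. I \<in> \<C> \<Longrightarrow> J \<in> \<C> \<Longrightarrow> I \<subseteq> J \<or> J \<subseteq> I"
  shows "lt_ideal \<Phi> (\<Union>\<C>)"
  unfolding lt_ideal_def
proof (intro conjI ballI)
  show "\<Union>\<C> \<subseteq> lt_carrier \<Phi>"
    using ideal unfolding lt_ideal_def by blast
  show "lt_meet \<Phi> x y \<in> \<Union>\<C>" if "x \<in> \<Union>\<C>" "y \<in> lt_carrier \<Phi>" for x y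
    using that ideal unfolding lt_ideal_def by blast
  show "lt_join \<Phi> x y \<in> \<Union>\<C>" if "x \<in> \<Union>\<C>" "y \<in> \<Union>\<C>" for x y
  proof -
    from that obtain I J where "I \<in> \<C>" "x \<in> I" "J \<in> \<C>" "y \<in> J" by blast
    with chain[of I J] obtain K where "K \<in> \<C>" "x \<in> K" "y \<in> K" by blast
    then show ?thesis using ideal unfolding lt_ideal_def by blast
  qed
qed

text \<open>The test of a default is exactly the consistency of the pair obtained by adding its
  conclusion. Groundedness survives because the prerequisite is already derived and the default
  counts as fired in the new pair.\<close>

lemma consistent_grounded_extend_P:
  assumes cg: "consistent_grounded \<Phi> \<Delta> (P, F)"
    and d: "PermD \<alpha> \<beta> \<in> \<Delta>" "cls \<Phi> \<alpha> \<in> P" "\<not> above \<Phi> (cls \<Phi> \<beta>) (P_dual \<Phi>)"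
    and test: "gen_ideal \<Phi> (P \<union> {cls \<Phi> \<beta>}) \<inter> F = {cls \<Phi> 0\<^sub>a}"
  shows "consistent_grounded \<Phi> \<Delta> (gen_ideal \<Phi> (P \<union> {cls \<Phi> \<beta>}), F)"
proof -
  let ?P = "gen_ideal \<Phi> (P \<union> {cls \<Phi> \<beta>})"
  have sub: "P \<subseteq> ?P" "cls \<Phi> \<beta> \<in> ?P"
    using gen_ideal_superset[of "P \<union> {cls \<Phi> \<beta>}" \<Phi>] by auto
  have "?P \<subseteq> Q \<and> F \<subseteq> G" if QG: "fired_closed \<Phi> \<Delta> ?P F Q G" for Q G
  proof -
    have le: "P \<subseteq> Q" "F \<subseteq> G"
      using cg fired_closed_antimono[OF QG sub(1) subset_refl]
      by (auto simp: consistent_grounded_def grounded_def)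
    \<comment> \<open>The prerequisite lies in \<open>P\<close> and hence in \<open>Q\<close>; the
      conclusion lies in \<open>?P\<close>, so this default is among those under which
      \<open>Q\<close> is closed.\<close>
    then have "cls \<Phi> \<beta> \<in> Q"
      using QG d sub(2) unfolding fired_closed_def by blast
    then have "?P \<subseteq> Q"
      using QG le by (intro gen_ideal_least) (auto simp: fired_closed_def)
    then show ?thesis using le by blast
  qed
  then show ?thesis
    using cg sub(1) test lt_ideal_gen_ideal_insert
    by (auto simp: consistent_grounded_def grounded_def)
qed

text \<open>The mirror image of \<open>consistent_grounded_extend_P\<close>, with the intersection
  in the test taken in the opposite order.\<close>

lemma consistent_grounded_extend_F:
  assumes cg: "consistent_grounded \<Phi> \<Delta> (P, F)"
    and d: "ForbD \<alpha> \<beta> \<in> \<Delta>" "cls \<Phi> \<alpha> \<in> F" "\<not> above \<Phi> (cls \<Phi> \<beta>) (F_dual \<Phi>)"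
    and test: "gen_ideal \<Phi> (F \<union> {cls \<Phi> \<beta>}) \<inter> P = {cls \<Phi> 0\<^sub>a}"
  shows "consistent_grounded \<Phi> \<Delta> (P, gen_ideal \<Phi> (F \<union> {cls \<Phi> \<beta>}))"
proof -
  let ?F = "gen_ideal \<Phi> (F \<union> {cls \<Phi> \<beta>})"
  have sub: "F \<subseteq> ?F" "cls \<Phi> \<beta> \<in> ?F"
    using gen_ideal_superset[of "F \<union> {cls \<Phi> \<beta>}" \<Phi>] by auto
  have "P \<subseteq> Q \<and> ?F \<subseteq> G" if QG: "fired_closed \<Phi> \<Delta> P ?F Q G" for Q G
  proof -
    have le: "P \<subseteq> Q" "F \<subseteq> G"
      using cg fired_closed_antimono[OF QG subset_refl sub(1)]
      by (auto simp: consistent_grounded_def grounded_def)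
    then have "cls \<Phi> \<beta> \<in> G"
      using QG d sub(2) unfolding fired_closed_def by blast
    then have "?F \<subseteq> G"
      using QG le by (intro gen_ideal_least) (auto simp: fired_closed_def)
    then show ?thesis using le by blast
  qed
  moreover have "P \<inter> ?F = {cls \<Phi> 0\<^sub>a}" using test by blast
  ultimately show ?thesis
    using cg sub(1) lt_ideal_gen_ideal_insert
    by (auto simp: consistent_grounded_def grounded_def)
qed

text \<open>A common element of the two unions comes from \<open>fst x\<close> and
  \<open>snd y\<close>, and the larger of \<open>x\<close> and \<open>y\<close> has it in both
  components, so it is zero. A pair closed relative to the union is closed relative to each member,
  hence contains each member.\<close>

lemma consistent_grounded_Union_chain:
  assumes ne: "C \<noteq> {}"
    and cg: "\<And>x. x \<in> C \<Longrightarrow> consistent_grounded \<Phi> \<Delta> x"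
    and chain: "\<And>x y. x \<in> C \<Longrightarrow> y \<in> C \<Longrightarrow> pair_le x y \<or> pair_le y x"
  shows "consistent_grounded \<Phi> \<Delta> (\<Union> (fst ` C), \<Union> (snd ` C))"
proof -
  let ?P = "\<Union> (fst ` C)" and ?F = "\<Union> (snd ` C)"
  have mem: "lt_ideal \<Phi> (fst x)" "lt_ideal \<Phi> (snd x)" "P_ideal \<Phi> \<subseteq> fst x"
    "F_ideal \<Phi> \<subseteq> snd x" "fst x \<inter> snd x = {cls \<Phi> 0\<^sub>a}" "grounded \<Phi> \<Delta> (fst x) (snd x)"
    if "x \<in> C" for x
    using cg[OF that] by (simp_all add: consistent_grounded_def case_prod_unfold)
  have "lt_ideal \<Phi> ?P"
    by (rule lt_ideal_Union_chain) (use mem(1,2) chain[unfolded pair_le_def] in blast)+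
  moreover have "lt_ideal \<Phi> ?F"
    by (rule lt_ideal_Union_chain) (use mem(1,2) chain[unfolded pair_le_def] in blast)+
  moreover have "P_ideal \<Phi> \<subseteq> ?P" "F_ideal \<Phi> \<subseteq> ?F"
    using ne mem(3,4) by blast+
  moreover have "?P \<inter> ?F = {cls \<Phi> 0\<^sub>a}"
  proof
    show "?P \<inter> ?F \<subseteq> {cls \<Phi> 0\<^sub>a}"
    proof
      fix z assume "z \<in> ?P \<inter> ?F"
      then obtain x y where xy: "x \<in> C" "y \<in> C" "z \<in> fst x" "z \<in> snd y" by blast
      with chain[of x y] have "z \<in> fst y \<inter> snd y \<or> z \<in> fst x \<inter> snd x"
        unfolding pair_le_def by blast
      then show "z \<in> {cls \<Phi> 0\<^sub>a}" using xy mem(5) by blast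
    qed
    show "{cls \<Phi> 0\<^sub>a} \<subseteq> ?P \<inter> ?F" using ne mem(5) by blast
  qed
  moreover have "grounded \<Phi> \<Delta> ?P ?F"
    unfolding grounded_def
  proof (intro allI impI)
    fix Q G assume QG: "fired_closed \<Phi> \<Delta> ?P ?F Q G"
    have "fst x \<subseteq> Q \<and> snd x \<subseteq> G" if "x \<in> C" for x
    proof -
      have "fired_closed \<Phi> \<Delta> (fst x) (snd x) Q G"
        by (rule fired_closed_antimono[OF QG]) (use that in blast)+
      then show ?thesis using mem(6)[OF that] unfolding grounded_def by blast
    qed
    then show "?P \<subseteq> Q \<and> ?F \<subseteq> G" by blast
  qed
  ultimately show ?thesis by (simp add: consistent_grounded_def)
qed

lemma maximal_consistent_grounded_exists:
  assumes "P_ideal \<Phi> \<inter> F_ideal \<Phi> = {cls \<Phi> 0\<^sub>a}"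
  shows "\<exists>m. consistent_grounded \<Phi> \<Delta> m \<and>
    (\<forall>x. consistent_grounded \<Phi> \<Delta> x \<longrightarrow> pair_le m x \<longrightarrow> x = m)"
proof -
  let ?A = "{x. consistent_grounded \<Phi> \<Delta> x}"
  \<comment> \<open>This pair is trivially grounded, and it serves as the upper bound of the empty
    chain.\<close>
  have init: "(P_ideal \<Phi>, F_ideal \<Phi>) \<in> ?A"
    using assms by (simp add: consistent_grounded_def grounded_def fired_closed_def
        lt_ideal_P_ideal lt_ideal_F_ideal)
  have "\<exists>m\<in>?A. \<forall>a\<in>?A. pair_le m a \<longrightarrow> a = m"
  proof (rule predicate_Zorn)
    show "partial_order_on ?A (relation_of pair_le ?A)"
      by (rule partial_order_on_relation_ofI) (auto simp: pair_le_def)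
  next
    fix C assume C: "C \<in> Chains (relation_of pair_le ?A)"
    have chain: "pair_le x y \<or> pair_le y x" if "x \<in> C" "y \<in> C" for x y
      using C that unfolding Chains_def relation_of_def by blast
    have sub: "C \<subseteq> ?A"
      using C unfolding Chains_def relation_of_def by blast
    show "\<exists>u\<in>?A. \<forall>a\<in>C. pair_le a u"
    proof (cases "C = {}")
      case True
      then show ?thesis using init by blast
    next
      case False
      then have "(\<Union> (fst ` C), \<Union> (snd ` C)) \<in> ?A"
        using consistent_grounded_Union_chain[of C \<Phi> \<Delta>] sub chain by blast
      moreover have "\<forall>a\<in>C. pair_le a (\<Union> (fst ` C), \<Union> (snd ` C))"
        by (auto simp: pair_le_def)
      ultimately show ?thesis by blast
    qed
  qed
  then show ?thesis by blast
qed

lemma maximal_consistent_grounded_ext_least: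
  assumes cg: "consistent_grounded \<Phi> \<Delta> (P, F)"
    and max: "\<And>x. consistent_grounded \<Phi> \<Delta> x \<Longrightarrow> pair_le (P, F) x \<Longrightarrow> x = (P, F)"
  shows "ext_least \<Phi> \<Delta> P F P F"
proof -
  have base: "lt_ideal \<Phi> P" "lt_ideal \<Phi> F" "P_ideal \<Phi> \<subseteq> P" "F_ideal \<Phi> \<subseteq> F"
    "P \<inter> F = {cls \<Phi> 0\<^sub>a}" "grounded \<Phi> \<Delta> P F"
    using cg by (simp_all add: consistent_grounded_def)
  \<comment> \<open>Adding the conclusion gives a consistent grounded pair above
    \<open>(P, F)\<close>, which maximality identifies with \<open>(P, F)\<close>.\<close>
  have P: "cls \<Phi> \<beta> \<in> P"
    if "PermD \<alpha> \<beta> \<in> \<Delta>" "cls \<Phi> \<alpha> \<in> P"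
      "gen_ideal \<Phi> (P \<union> {cls \<Phi> \<beta>}) \<inter> F = {cls \<Phi> 0\<^sub>a}"
      "\<not> above \<Phi> (cls \<Phi> \<beta>) (P_dual \<Phi>)" for \<alpha> \<beta>
    using max[OF consistent_grounded_extend_P[OF cg that(1,2,4,3)]]
      gen_ideal_superset[of "P \<union> {cls \<Phi> \<beta>}" \<Phi>] by (auto simp: pair_le_def)
  have F: "cls \<Phi> \<beta> \<in> F"
    if "ForbD \<alpha> \<beta> \<in> \<Delta>" "cls \<Phi> \<alpha> \<in> F"
      "gen_ideal \<Phi> (F \<union> {cls \<Phi> \<beta>}) \<inter> P = {cls \<Phi> 0\<^sub>a}"
      "\<not> above \<Phi> (cls \<Phi> \<beta>) (F_dual \<Phi>)" for \<alpha> \<beta>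
    using max[OF consistent_grounded_extend_F[OF cg that(1,2,4,3)]]
      gen_ideal_superset[of "F \<union> {cls \<Phi> \<beta>}" \<Phi>] by (auto simp: pair_le_def)
  have closed: "ext_closed \<Phi> \<Delta> P F P F"
    unfolding ext_closed_def using base P F by simp
  have least: "P \<subseteq> Q \<and> F \<subseteq> G" if QG: "ext_closed \<Phi> \<Delta> P F Q G" for Q G
  proof -
    \<comment> \<open>Fired defaults pass the test, so closure in the sense of
      \<open>ext_closed\<close> implies \<open>fired_closed\<close>, and groundedness applies to
      \<open>(Q, G)\<close>.\<close>
    have testP: "gen_ideal \<Phi> (P \<union> {x}) \<inter> F = {cls \<Phi> 0\<^sub>a}" if "x \<in> P" for x
      using gen_ideal_absorb[OF base(1) that] base(5) by simp
    have testF: "gen_ideal \<Phi> (F \<union> {x}) \<inter> P = {cls \<Phi> 0\<^sub>a}" if "x \<in> F" for x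
      using gen_ideal_absorb[OF base(2) that] base(5) by blast
    have "fired_closed \<Phi> \<Delta> P F Q G"
      unfolding fired_closed_def
      using ext_closed_base[OF QG] ext_closed_PermD[OF QG _ _ testP]
        ext_closed_ForbD[OF QG _ _ testF] by simp
    then show ?thesis using base(6) unfolding grounded_def by blast
  qed
  show ?thesis unfolding ext_least_def using closed least by blast
qed

text \<open>A common nonzero element persists when either ideal is enlarged, so every test fails and
  only the clauses on the initial ideals remain.\<close>

lemma ext_least_inconsistent:
  assumes "P_ideal \<Phi> \<inter> F_ideal \<Phi> \<noteq> {cls \<Phi> 0\<^sub>a}"
  shows "ext_least \<Phi> \<Delta> (P_ideal \<Phi>) (F_ideal \<Phi>) (P_ideal \<Phi>) (F_ideal \<Phi>)"
proof -
  obtain z where z: "z \<in> P_ideal \<Phi>" "z \<in> F_ideal \<Phi>" "z \<noteq> cls \<Phi> 0\<^sub>a"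
    using assms zero_in_P_ideal zero_in_F_ideal by blast
  have "gen_ideal \<Phi> (P_ideal \<Phi> \<union> {x}) \<inter> F_ideal \<Phi> \<noteq> {cls \<Phi> 0\<^sub>a}" for x
    using z gen_ideal_superset[of "P_ideal \<Phi> \<union> {x}" \<Phi>] by blast
  moreover have "gen_ideal \<Phi> (F_ideal \<Phi> \<union> {x}) \<inter> P_ideal \<Phi> \<noteq> {cls \<Phi> 0\<^sub>a}" for x
    using z gen_ideal_superset[of "F_ideal \<Phi> \<union> {x}" \<Phi>] by blast
  ultimately show ?thesis
    by (simp add: ext_least_def ext_closed_def lt_ideal_P_ideal lt_ideal_F_ideal)
qed

theorem mainTheorem2:
  fixes \<Phi> :: "fm set" and \<Delta> :: "deontic_default set"
  assumes "consistent \<Phi>"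
  shows "\<exists>P F. algebraic_extension \<Phi> \<Delta> (P, F)"
proof -
  \<comment> \<open>By \<open>ext_op_eq_iff\<close>, a fixed point is a pair that is least for the
    tests made at itself.\<close>
  obtain P F where least: "ext_least \<Phi> \<Delta> P F P F"
  proof (cases "P_ideal \<Phi> \<inter> F_ideal \<Phi> = {cls \<Phi> 0\<^sub>a}")
    case True
    from maximal_consistent_grounded_exists[OF this, of \<Delta>] show ?thesis
      using that maximal_consistent_grounded_ext_least by (metis surj_pair)
  next
    case False
    then show ?thesis using that ext_least_inconsistent by blast
  qed
  then have "lt_ideal \<Phi> P" "lt_ideal \<Phi> F"
    using ext_closed_base(1,2) unfolding ext_least_def by blast+
  with least have "algebraic_extension \<Phi> \<Delta> (P, F)"
    using ext_op_eq_iff[of \<Phi> \<Delta> P F P F] by (simp add: algebraic_extension_def)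
  then show ?thesis by blast
qed

end
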